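(* Let $n \ge 3$ be an integer and consider the system $A + B = C$, $ABC = D^n$ in positive integers $A,B,C,D$. If $n \not\equiv 0 \pmod 3$, the system has infinitely many positive integer solutions $(A,B,C,D)$. If $n \equiv 0 \pmod 3$, the system has no positive integer solutions. *)

theory Defs
  imports Complex_Main "HOL-Number_Theory.Cong"
begin

definition positive_solutions :: "nat \<Rightarrow> (nat \<times> nat \<times> nat \<times> nat) set" where
  "positive_solutions n =
    {(A, B, C, D). A > 0 \<and> B > 0 \<and> C > 0 \<and> D > 0 \<and> A + B = C \<and> A * B * C = D ^ n}"

end

theory Submission
  imports Defs "HOL-Computational_Algebra.Nth_Powers"
begin

text \<open>
  If \<open>3\<close> does not divide \<open>n\<close>, the triple \<open>(1, 1, 2)\<close> with product \<open>2\<close> can be scaled by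
  \<open>2 ^ s * t ^ n\<close>, where \<open>n\<close> divides \<open>3 * s + 1\<close>, to make the product an \<open>n\<close>-th power.
  If \<open>3\<close> divides \<open>n\<close>, dividing a solution by the gcd of \<open>A\<close> and \<open>B\<close> leaves pairwise coprime
  numbers whose product is a cube, so each is a cube, contradicting Fermat's last theorem for
  exponent \<open>3\<close>. The latter is a descent in the Eisenstein integers, on the norm of \<open>c\<close> in
  \<open>a\<^sup>3 + b\<^sup>3 + u * c\<^sup>3 = 0\<close>, with \<open>u\<close> a unit and \<open>c\<close> divisible by \<open>\<lambda> = 1 - \<omega>\<close>:
  the elements \<open>p = (a + b) / \<lambda>\<close>, \<open>q = \<omega> * (a + \<omega> * b) / \<lambda>\<close>, \<open>r = \<omega>\<^sup>2 * (a + \<omega>\<^sup>2 * b) / \<lambda>\<close>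
  are pairwise coprime and satisfy \<open>p + q + r = 0\<close> and \<open>p * q * r = - u * (c / \<lambda>)\<^sup>3\<close>. Hence they
  are cubes up to units, and, since \<open>\<lambda>\<close> divides \<open>c / \<lambda>\<close> by a congruence modulo \<open>9\<close>, they
  yield a solution whose \<open>c\<close> has smaller norm.
\<close>

section \<open>Comaximal elements\<close>

text \<open>Coprimality in Bezout form: it makes sense in every commutative ring, so the Eisenstein
  integers need no gcd function and no unique factorization.\<close>

definition comaximal :: "'a::comm_ring_1 \<Rightarrow> 'a \<Rightarrow> bool" where
  "comaximal a b \<longleftrightarrow> (\<exists>s t. s * a + t * b = 1)"

lemma comaximal_commute: "comaximal a b \<longleftrightarrow> comaximal b a"
  unfolding comaximal_def by (metis add.commute)

lemma comaximal_dvd: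
  assumes "comaximal a b" "c dvd a" "d dvd b"
  shows "comaximal c d"
proof -
  obtain s t where st: "s * a + t * b = 1" using assms(1) unfolding comaximal_def by auto
  obtain k l where kl: "a = c * k" "b = d * l" using assms(2,3) by (auto elim!: dvdE)
  have "(s * k) * c + (t * l) * d = 1" using st kl by (simp add: algebra_simps)
  then show ?thesis unfolding comaximal_def by blast
qed

lemma comaximal_mult_right:
  assumes "comaximal a b" "comaximal a c"
  shows "comaximal a (b * c)"
proof -
  obtain s t where st: "s * a + t * b = 1" using assms(1) unfolding comaximal_def by auto
  obtain u v where uv: "u * a + v * c = 1" using assms(2) unfolding comaximal_def by auto
  have "(s * a + t * b) * (u * a + v * c) = 1" using st uv by simp
  then have "(s * u * a + s * v * c + t * b * u) * a + (t * v) * (b * c) = 1"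
    by (simp add: algebra_simps)
  then show ?thesis unfolding comaximal_def by blast
qed

lemma comaximal_add_eq_0:
  assumes "comaximal p q" "p + q + r = 0"
  shows "comaximal p r"
proof -
  obtain s t where st: "s * p + t * q = 1" using assms(1) unfolding comaximal_def by auto
  have "(s - t) * p + (- t) * r = (s * p + t * q) - t * (p + q + r)" by (simp add: algebra_simps)
  then have "(s - t) * p + (- t) * r = 1" using st assms(2) by simp
  then show ?thesis unfolding comaximal_def by blast
qed

text \<open>Here \<open>g\<close> is a gcd of \<open>p\<close> and \<open>e\<close> in Bezout form,
  and \<open>p\<close> and \<open>g ^ 3\<close> turn out to divide each other. For
  \<open>p dvd g ^ 3\<close>, expand \<open>(x * p + y * e) ^ 3\<close>: every term contains
  \<open>p\<close> or \<open>e ^ 3\<close>, and \<open>p\<close> divides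
  \<open>e ^ 3\<close>.\<close>

lemma comaximal_mult_eq_cube:
  fixes p m e w g :: "'a::idom"
  assumes com: "comaximal p m" and eq: "p * m = w * e ^ 3" and w: "w dvd 1"
    and p: "p \<noteq> 0" and gp: "g dvd p" and ge: "g dvd e" and g: "g = x * p + y * e"
  shows "\<exists>u. u dvd 1 \<and> p = u * g ^ 3"
proof -
  obtain v where v: "1 = w * v" using w by (elim dvdE)
  have "e ^ 3 = v * (w * e ^ 3)" using v by (metis mult.assoc mult.commute mult_1)
  then have e3: "e ^ 3 = p * (m * v)" using eq by (metis mult.assoc mult.commute)
  have "g ^ 3 = p * (x ^ 3 * p\<^sup>2 + 3 * x\<^sup>2 * p * y * e + 3 * x * y\<^sup>2 * e\<^sup>2) + y ^ 3 * e ^ 3"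
    unfolding g by (simp add: power3_eq_cube power2_eq_square algebra_simps)
  then have "p dvd g ^ 3" using e3 by simp
  then obtain l where l: "g ^ 3 = p * l" by (elim dvdE)
  obtain s t where st: "s * p + t * m = 1" using com unfolding comaximal_def by auto
  \<comment> \<open>Inserting the square of \<open>s * p + t * m = 1\<close> leaves only terms with
    \<open>p ^ 3\<close> or with \<open>p * m = w * e ^ 3\<close>, all divisible by
    \<open>g ^ 3\<close>.\<close>
  have "p = p * (s * p + t * m)\<^sup>2" using st by simp
  also have "\<dots> = s\<^sup>2 * p ^ 3 + (p * m) * (2 * s * p * t + t\<^sup>2 * m)"
    by (simp add: power3_eq_cube power2_eq_square algebra_simps)
  also have "\<dots> = s\<^sup>2 * p ^ 3 + e ^ 3 * (w * (2 * s * p * t + t\<^sup>2 * m))"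
    unfolding eq by (simp add: algebra_simps)
  finally have *: "p = s\<^sup>2 * p ^ 3 + e ^ 3 * (w * (2 * s * p * t + t\<^sup>2 * m))" .
  have "g ^ 3 dvd s\<^sup>2 * p ^ 3 + e ^ 3 * (w * (2 * s * p * t + t\<^sup>2 * m))"
    by (intro dvd_add dvd_mult dvd_mult2 dvd_power_same gp ge)
  then have "g ^ 3 dvd p" using * by simp
  then obtain k where k: "p = g ^ 3 * k" by (elim dvdE)
  have "p * 1 = p * (l * k)" using k l by (metis mult.assoc mult.right_neutral)
  then have "1 = k * l" using p by (metis mult.commute mult_left_cancel)
  then have "k dvd 1" by (metis dvd_triv_left)
  then show ?thesis using k by (metis mult.commute)
qed

section \<open>Eisenstein integers\<close>

text \<open>\<open>Eis a b\<close> stands for \<open>a + b * \<omega>\<close>, where \<open>\<omega>\<^sup>2 = - 1 - \<omega>\<close>.\<close>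

datatype eisenstein = Eis int int

instantiation eisenstein :: comm_ring_1
begin

definition "0 = Eis 0 0"
definition "1 = Eis 1 0"
fun plus_eisenstein where "Eis a b + Eis c d = Eis (a + c) (b + d)"
fun uminus_eisenstein where "- Eis a b = Eis (- a) (- b)"
fun minus_eisenstein where "Eis a b - Eis c d = Eis (a - c) (b - d)"
fun times_eisenstein where
  "Eis a b * Eis c d = Eis (a * c - b * d) (a * d + b * c - b * d)"

instance
proof
  fix a b c :: eisenstein
  show "a + b + c = a + (b + c)" by (cases a; cases b; cases c) simp
  show "a + b = b + a" by (cases a; cases b) simp
  show "0 + a = a" by (cases a) (simp add: zero_eisenstein_def)
  show "- a + a = 0" by (cases a) (simp add: zero_eisenstein_def)
  show "a - b = a + - b" by (cases a; cases b) simp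
  show "a * b * c = a * (b * c)" by (cases a; cases b; cases c) (simp add: algebra_simps)
  show "a * b = b * a" by (cases a; cases b) simp
  show "1 * a = a" by (cases a) (simp add: one_eisenstein_def)
  show "(a + b) * c = a * c + b * c" by (cases a; cases b; cases c) (simp add: algebra_simps)
  show "(0::eisenstein) \<noteq> 1" by (simp add: zero_eisenstein_def one_eisenstein_def)
qed

end

section \<open>The norm, division with remainder and Bezout identities\<close>

fun eis_norm :: "eisenstein \<Rightarrow> int" where
  "eis_norm (Eis a b) = a\<^sup>2 - a * b + b\<^sup>2"

text \<open>Complex conjugation, as \<omega> has conjugate \<open>- 1 - \<omega>\<close>;
  \<open>eis_norm\<close> is the squared absolute value.\<close>

fun eis_conj :: "eisenstein \<Rightarrow> eisenstein" where
  "eis_conj (Eis a b) = Eis (a - b) (- b)"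

lemma eis_norm_mult: "eis_norm (x * y) = eis_norm x * eis_norm y"
  by (cases x; cases y) (simp add: power2_eq_square algebra_simps)

lemma eis_norm_power: "eis_norm (x ^ n) = eis_norm x ^ n"
  by (induction n) (simp_all add: eis_norm_mult one_eisenstein_def)

lemma four_eis_norm: "4 * eis_norm (Eis a b) = (2 * a - b)\<^sup>2 + 3 * b\<^sup>2"
  by (simp add: power2_eq_square algebra_simps)

lemma eis_norm_nonneg: "eis_norm x \<ge> 0"
proof (cases x)
  case (Eis a b)
  have "4 * eis_norm (Eis a b) \<ge> 0" unfolding four_eis_norm by simp
  then show ?thesis using Eis by simp
qed

lemma eis_norm_eq_0_iff [simp]: "eis_norm x = 0 \<longleftrightarrow> x = 0"
proof (cases x)
  case (Eis a b)
  have "a = 0 \<and> b = 0" if "eis_norm x = 0"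
  proof -
    have "(2 * a - b)\<^sup>2 + 3 * b\<^sup>2 = 0" using that four_eis_norm[of a b] Eis by simp
    moreover have "(2 * a - b)\<^sup>2 \<ge> 0" "b\<^sup>2 \<ge> 0" by simp_all
    ultimately have "(2 * a - b)\<^sup>2 = 0" "b\<^sup>2 = 0" by linarith+
    then show ?thesis by simp
  qed
  then show ?thesis using Eis by (auto simp: zero_eisenstein_def)
qed

lemma eis_norm_pos: "x \<noteq> 0 \<Longrightarrow> eis_norm x > 0"
  using eis_norm_nonneg[of x] eis_norm_eq_0_iff[of x] by linarith

instance eisenstein :: idom
proof
  fix a b :: eisenstein
  assume "a \<noteq> 0" "b \<noteq> 0"
  then show "a * b \<noteq> 0" by (metis eis_norm_eq_0_iff eis_norm_mult mult_eq_0_iff)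
qed

lemma eis_mult_conj: "x * eis_conj x = Eis (eis_norm x) 0"
  by (cases x) (simp add: power2_eq_square algebra_simps)

lemma eis_norm_conj: "eis_norm (eis_conj x) = eis_norm x"
  by (cases x) (simp add: power2_eq_square algebra_simps)

lemma exists_nearest_multiple:
  fixes m N :: int
  assumes "N > 0"
  shows "\<exists>k. \<bar>2 * (m - k * N)\<bar> \<le> N"
proof
  \<comment> \<open>This is the floor of \<open>m / N + 1 / 2\<close>, that is, \<open>m / N\<close>
    rounded to a nearest integer.\<close>
  define k where "k = (2 * m + N) div (2 * N)"
  have "2 * m + N = 2 * N * k + (2 * m + N) mod (2 * N)" unfolding k_def by simp
  moreover have "0 \<le> (2 * m + N) mod (2 * N)" "(2 * m + N) mod (2 * N) < 2 * N"
    using assms by simp_all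
  ultimately show "\<bar>2 * (m - k * N)\<bar> \<le> N" by (simp add: algebra_simps abs_le_iff)
qed

text \<open>The exact quotient is \<open>x * eis_conj y\<close> divided by
  \<open>N = eis_norm y\<close>. Rounding both coordinates leaves errors of at most 1/2, hence an
  error of norm at most 3/4.\<close>

lemma eis_division:
  assumes "y \<noteq> 0"
  shows "\<exists>q. eis_norm (x - q * y) < eis_norm y"
proof -
  define N where "N = eis_norm y"
  have N: "N > 0" using assms eis_norm_pos N_def by simp
  obtain m n where mn: "x * eis_conj y = Eis m n" by (cases "x * eis_conj y")
  obtain k where k: "\<bar>2 * (m - k * N)\<bar> \<le> N" using exists_nearest_multiple[OF N] by blast
  obtain l where l: "\<bar>2 * (n - l * N)\<bar> \<le> N" using exists_nearest_multiple[OF N] by blast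
  define r where "r = m - k * N"
  define s where "s = n - l * N"
  have "(x - Eis k l * y) * eis_conj y = x * eis_conj y - Eis k l * (y * eis_conj y)"
    by (simp add: algebra_simps)
  also have "\<dots> = Eis r s"
    unfolding mn eis_mult_conj N_def[symmetric] r_def s_def by simp
  finally have "eis_norm (x - Eis k l * y) * N = eis_norm (Eis r s)"
    by (metis N_def eis_norm_conj eis_norm_mult)
  moreover have "eis_norm (Eis r s) < N * N"
  proof -
    have r2: "(2 * r)\<^sup>2 \<le> N\<^sup>2" using k N r_def by (metis abs_le_square_iff abs_of_pos)
    have s2: "(2 * s)\<^sup>2 \<le> N\<^sup>2" using l N s_def by (metis abs_le_square_iff abs_of_pos)
    \<comment> \<open>Expanding this square bounds the mixed term \<open>- r * s\<close> of the norm
      by half the sum of the squares.\<close>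
    have "(r + s)\<^sup>2 \<ge> 0" by simp
    then have "2 * eis_norm (Eis r s) \<le> 3 * (r\<^sup>2 + s\<^sup>2)"
      by (simp add: power2_eq_square algebra_simps)
    moreover have "4 * (r\<^sup>2 + s\<^sup>2) \<le> 2 * N\<^sup>2" using r2 s2 by (simp add: power_mult_distrib)
    moreover have "N\<^sup>2 > 0" using N by simp
    moreover have "E < M" if "2 * E \<le> 3 * T" "4 * T \<le> 2 * M" "M > 0" for E T M :: int
      using that by linarith
    ultimately have "eis_norm (Eis r s) < N\<^sup>2" by blast
    then show ?thesis by (simp add: power2_eq_square)
  qed
  ultimately have "eis_norm (x - Eis k l * y) < N"
    using N by (metis mult_less_cancel_right_pos)
  then show ?thesis using N_def by blast
qed

text \<open>A nonzero element \<open>g\<close> of least norm in the ideal generated by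
  \<open>a\<close> and \<open>b\<close> divides the whole ideal, since the remainder of a division
  by \<open>g\<close> lies in the ideal and has smaller norm.\<close>

lemma eis_bezout:
  fixes a b :: eisenstein
  assumes "a \<noteq> 0"
  shows "\<exists>x y g. g = x * a + y * b \<and> g dvd a \<and> g dvd b"
proof -
  define I where "I = {z. z \<noteq> 0 \<and> (\<exists>x y. z = x * a + y * b)}"
  have "1 * a + 0 * b = a" by simp
  then have "a \<in> I" unfolding I_def using assms by (metis (mono_tags, lifting) mem_Collect_eq)
  then obtain g where g: "g \<in> I"
    and min: "\<And>z. z \<in> I \<Longrightarrow> nat (eis_norm g) \<le> nat (eis_norm z)"
    using ex_has_least_nat[of "\<lambda>z. z \<in> I" a "\<lambda>z. nat (eis_norm z)"] by auto
  obtain x y where xy: "g = x * a + y * b" and g0: "g \<noteq> 0" using g I_def by auto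
  have div: "g dvd v * a + w * b" for v w
  proof -
    obtain q where q: "eis_norm (v * a + w * b - q * g) < eis_norm g"
      using eis_division[OF g0] by blast
    have "v * a + w * b - q * g = (v - q * x) * a + (w - q * y) * b"
      unfolding xy by (simp add: algebra_simps)
    moreover have "v * a + w * b - q * g \<notin> I"
      using min q eis_norm_pos[OF g0] by fastforce
    ultimately have "v * a + w * b - q * g = 0" unfolding I_def by auto
    then show ?thesis by simp
  qed
  have "g dvd a" using div[of 1 0] by simp
  moreover have "g dvd b" using div[of 0 1] by simp
  ultimately show ?thesis using xy by blast
qed

lemma eis_coprime_factor_of_cube:
  fixes p m e w :: eisenstein
  assumes "comaximal p m" "p * m = w * e ^ 3" "w dvd 1" "p \<noteq> 0"
  shows "\<exists>u g. u dvd 1 \<and> p = u * g ^ 3"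
proof -
  obtain x y g where "g = x * p + y * e" "g dvd p" "g dvd e"
    using eis_bezout[OF assms(4)] by blast
  then show ?thesis using comaximal_mult_eq_cube[OF assms] by blast
qed

lemma eis_norm_unit:
  assumes "u dvd 1"
  shows "eis_norm u = 1"
proof -
  obtain v where "1 = u * v" using assms by (elim dvdE)
  then have "eis_norm u * eis_norm v = 1"
    by (metis eis_norm_mult eis_norm_power mult_1 power_0)
  then show ?thesis using eis_norm_nonneg[of u] by (auto simp: zmult_eq_1_iff)
qed

section \<open>Congruences modulo the prime above 3\<close>

definition eis_omega :: eisenstein where "eis_omega = Eis 0 1"

definition eis_lambda :: eisenstein where "eis_lambda = Eis 1 (- 1)"

lemma eis_omega_square: "eis_omega\<^sup>2 = - 1 - eis_omega"
  by (simp add: eis_omega_def one_eisenstein_def power2_eq_square)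

lemma eis_lambda_nonzero: "eis_lambda \<noteq> 0"
  by (simp add: eis_lambda_def zero_eisenstein_def)

lemma eis_norm_lambda: "eis_norm eis_lambda = 3"
  by (simp add: eis_lambda_def)

lemma eis_of_int: "of_int k = Eis k 0"
proof -
  have *: "of_nat n = Eis (int n) 0" for n
    by (induction n) (simp_all add: zero_eisenstein_def one_eisenstein_def)
  show ?thesis by (cases k rule: int_cases2) (simp_all add: *)
qed

lemma eis_numeral: "numeral k = Eis (numeral k) 0"
  by (metis eis_of_int of_int_numeral)

lemma eis_of_int_dvd_iff: "of_int k dvd Eis a b \<longleftrightarrow> k dvd a \<and> k dvd b"
proof
  assume "of_int k dvd Eis a b"
  then obtain z where "Eis a b = of_int k * z" by (elim dvdE)
  then show "k dvd a \<and> k dvd b" by (cases z) (simp add: eis_of_int)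
next
  assume "k dvd a \<and> k dvd b"
  then obtain c d where "a = k * c" "b = k * d" by (auto elim!: dvdE)
  then have "Eis a b = of_int k * Eis c d" by (simp add: eis_of_int)
  then show "of_int k dvd Eis a b" by simp
qed

text \<open>Modulo \<open>eis_lambda\<close> one has \<omega> = 1, so the residue of
  \<open>Eis a b\<close> is \<open>a + b\<close> in the field with three elements.\<close>

lemma eis_lambda_dvd_iff: "eis_lambda dvd Eis a b \<longleftrightarrow> 3 dvd a + b"
proof
  assume "eis_lambda dvd Eis a b"
  then obtain z where z: "Eis a b = eis_lambda * z" by (elim dvdE)
  obtain c d where "z = Eis c d" by (cases z)
  then have "a + b = 3 * d" using z by (simp add: eis_lambda_def)
  then show "3 dvd a + b" by simp
next
  assume "3 dvd a + b"
  then obtain d where "a + b = 3 * d" by (elim dvdE)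
  then have "Eis a b = eis_lambda * Eis (a - d) d" by (simp add: eis_lambda_def)
  then show "eis_lambda dvd Eis a b" by simp
qed

lemma int_dvd_3_cases:
  fixes k :: int
  shows "3 dvd k \<or> 3 dvd k - 1 \<or> 3 dvd k + 1"
  by presburger

lemma eis_mod_lambda_cases:
  "eis_lambda dvd x \<or> eis_lambda dvd x - 1 \<or> eis_lambda dvd x + 1"
proof (cases x)
  case (Eis a b)
  show ?thesis using int_dvd_3_cases[of "a + b"]
    by (simp add: Eis one_eisenstein_def eis_lambda_dvd_iff algebra_simps)
qed

lemma eis_lambda_not_dvd_1: "\<not> eis_lambda dvd 1"
  by (simp add: one_eisenstein_def eis_lambda_dvd_iff)

text \<open>The reduction \<open>a + b\<close> is multiplicative modulo 3, so primality of
  \<open>eis_lambda\<close> follows from that of 3.\<close>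

lemma eis_lambda_dvd_mult_iff:
  "eis_lambda dvd x * y \<longleftrightarrow> eis_lambda dvd x \<or> eis_lambda dvd y"
proof (cases x; cases y)
  fix a b c d
  assume x: "x = Eis a b" and y: "y = Eis c d"
  have p: "prime (3::int)" by simp
  have "(a * c - b * d) + (a * d + b * c - b * d) = (a + b) * (c + d) - 3 * (b * d)"
    by (simp add: algebra_simps)
  then have "3 dvd (a * c - b * d) + (a * d + b * c - b * d) \<longleftrightarrow> 3 dvd (a + b) * (c + d)"
    by (metis dvd_diff_left_iff dvd_triv_left)
  then show ?thesis
    unfolding x y times_eisenstein.simps eis_lambda_dvd_iff prime_dvd_mult_iff[OF p] .
qed

lemma eis_lambda_dvd_cube_iff: "eis_lambda dvd x ^ 3 \<longleftrightarrow> eis_lambda dvd x"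
  by (simp add: power3_eq_cube eis_lambda_dvd_mult_iff)

text \<open>This and the next identity both say that the square of \<open>eis_lambda\<close> is
  \<open>- 3 * \<omega>\<close>; the unit \<open>\<omega> + 1\<close> is the inverse of
  \<open>- \<omega>\<close>.\<close>

lemma eis_lambda_cube: "eis_lambda ^ 3 = 3 * (eis_lambda * (- eis_omega))"
  by (simp add: eis_numeral eis_lambda_def eis_omega_def power3_eq_cube)

lemma eis_lambda_square: "eis_lambda\<^sup>2 * (eis_omega + 1) = 3"
  by (simp add: eis_numeral eis_lambda_def eis_omega_def one_eisenstein_def power2_eq_square)

text \<open>Cubing lifts a congruence modulo \<open>eis_lambda\<close> to one modulo its fourth
  power, which is 9 up to a unit. The proof checks both coordinates after eliminating
  \<open>a\<close>.\<close>

lemma eis_cube_minus_1: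
  assumes "eis_lambda dvd x - 1"
  shows "9 dvd x ^ 3 - 1"
proof (cases x)
  case (Eis a b)
  have "3 dvd a - 1 + b" using assms by (simp add: Eis one_eisenstein_def eis_lambda_dvd_iff)
  then obtain m where "a - 1 + b = 3 * m" by (elim dvdE)
  then have a: "a = 3 * m + 1 - b" by simp
  have "x ^ 3 - 1 = Eis (a ^ 3 + b ^ 3 - 3 * a * b\<^sup>2 - 1) (3 * a * b * (a - b))"
    by (simp add: Eis one_eisenstein_def power3_eq_cube power2_eq_square algebra_simps)
  moreover have "9 dvd a ^ 3 + b ^ 3 - 3 * a * b\<^sup>2 - 1"
  proof -
    have *: "a ^ 3 + b ^ 3 - 3 * a * b\<^sup>2 - 1 =
      9 * (3 * m ^ 3 + 3 * m\<^sup>2 * (1 - b) + m * (1 - b)\<^sup>2 - m * b\<^sup>2) + 3 * ((b - 1) * b * (b + 1))"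
      unfolding a by (simp add: power3_eq_cube power2_eq_square algebra_simps)
    have "3 dvd (b - 1) * b * (b + 1)" using int_dvd_3_cases[of b] by auto
    then show ?thesis unfolding * by (auto elim!: dvdE)
  qed
  moreover have "9 dvd 3 * a * b * (a - b)"
  proof -
    \<comment> \<open>Modulo 3, the numbers \<open>b\<close>, \<open>a\<close> and
      \<open>a - b\<close> are up to sign \<open>b\<close>, \<open>b - 1\<close> and
      \<open>b + 1\<close>, so one of them vanishes.\<close>
    have *: "a - b = 3 * (m - b) + (b + 1)" "a = 3 * m - (b - 1)" unfolding a by simp_all
    have "3 dvd b \<or> 3 dvd a \<or> 3 dvd a - b" using int_dvd_3_cases[of b] * by presburger
    then have "3 dvd a * b * (a - b)" by auto
    then show ?thesis by (auto elim!: dvdE simp: mult.assoc)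
  qed
  ultimately show ?thesis using eis_of_int_dvd_iff[of 9] by simp
qed

lemma eis_cube_plus_1:
  assumes "eis_lambda dvd x + 1"
  shows "9 dvd x ^ 3 + 1"
proof -
  have "(- x) - 1 = - (x + 1)" by simp
  then have "eis_lambda dvd (- x) - 1" using assms by (simp only: dvd_minus_iff)
  from eis_cube_minus_1[OF this] have "9 dvd - (x ^ 3 + 1)"
    by (simp add: power3_eq_cube)
  then show ?thesis by (simp only: dvd_minus_iff)
qed

lemma eis_cube_mod_9:
  assumes "\<not> eis_lambda dvd x"
  obtains s :: int where "s = 1 \<or> s = - 1" "9 dvd x ^ 3 - of_int s"
proof -
  consider "eis_lambda dvd x - 1" | "eis_lambda dvd x + 1"
    using eis_mod_lambda_cases assms by blast
  then show thesis
  proof cases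
    case 1
    then show thesis using that[of 1] eis_cube_minus_1 by simp
  next
    case 2
    then show thesis using that[of "- 1"] eis_cube_plus_1 by simp
  qed
qed

text \<open>By the parallelogram law \<open>u + v\<close> has norm at most 4, whereas a nonzero
  multiple of 3 has norm at least 9.\<close>

lemma eis_units_cong_3:
  fixes u v :: eisenstein
  assumes "u dvd 1" "v dvd 1" "3 dvd u + v"
  shows "v = - u"
proof -
  have "eis_norm u = 1" "eis_norm v = 1" using assms eis_norm_unit by auto
  obtain z where z: "u + v = 3 * z" using assms(3) by (elim dvdE)
  have parallelogram: "eis_norm (u + v) + eis_norm (u - v) = 2 * eis_norm u + 2 * eis_norm v"
    by (cases u; cases v) (simp add: power2_eq_square algebra_simps)
  have "eis_norm (3 * z) = 9 * eis_norm z"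
    by (simp add: eis_numeral eis_norm_mult)
  then have "9 * eis_norm z \<le> 4"
    using z parallelogram eis_norm_nonneg[of "u - v"] \<open>eis_norm u = 1\<close> \<open>eis_norm v = 1\<close> by simp
  then have "eis_norm z = 0" using eis_norm_nonneg[of z] by linarith
  then show ?thesis using z by (simp add: eq_neg_iff_add_eq_0 add.commute)
qed

section \<open>The descent\<close>

text \<open>Each factor is a unit times a cube. Modulo 3 the relation \<open>p + q + r = 0\<close>
  forces the units of \<open>p\<close> and \<open>q\<close> to agree up to sign; dividing by one of
  them and moving the sign into \<open>b\<close> restores the shape needed for the descent.\<close>

lemma eis_cubes_from_factors:
  fixes p q r e w :: eisenstein
  assumes sum: "p + q + r = 0" and prod: "p * q * r = w * e ^ 3" and w: "w dvd 1"
    and e: "e \<noteq> 0" and com: "comaximal p q" and r: "eis_lambda dvd r"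
  shows "\<exists>a b c u. a ^ 3 + b ^ 3 + u * c ^ 3 = 0 \<and> u dvd 1 \<and> comaximal a b \<and>
    eis_lambda dvd c \<and> c \<noteq> 0 \<and> eis_norm c \<le> eis_norm e"
proof -
  have "w \<noteq> 0" using w by auto
  then have "p * q * r \<noteq> 0" using e prod by simp
  then have nz: "p \<noteq> 0" "q \<noteq> 0" "r \<noteq> 0" by auto
  have pr: "comaximal p r" using comaximal_add_eq_0[OF com sum] .
  have qr: "comaximal q r"
    using comaximal_add_eq_0[of q p r] com sum comaximal_commute by (metis add.commute)
  have prods: "p * (q * r) = w * e ^ 3" "q * (p * r) = w * e ^ 3" "r * (p * q) = w * e ^ 3"
    using prod by (simp_all add: ac_simps)
  have coms: "comaximal p (q * r)" "comaximal q (p * r)" "comaximal r (p * q)"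
    using com pr qr by (auto intro: comaximal_mult_right simp: comaximal_commute)
  obtain u1 a where a: "u1 dvd 1" "p = u1 * a ^ 3"
    using eis_coprime_factor_of_cube[OF coms(1) prods(1) w nz(1)] by blast
  obtain u2 b where b: "u2 dvd 1" "q = u2 * b ^ 3"
    using eis_coprime_factor_of_cube[OF coms(2) prods(2) w nz(2)] by blast
  obtain u3 c where c: "u3 dvd 1" "r = u3 * c ^ 3"
    using eis_coprime_factor_of_cube[OF coms(3) prods(3) w nz(3)] by blast
  have lam_unit: "\<not> eis_lambda dvd u" if "u dvd 1" for u
    using that eis_lambda_not_dvd_1 dvd_trans by blast
  have lc: "eis_lambda dvd c"
    using r c lam_unit by (simp add: eis_lambda_dvd_mult_iff eis_lambda_dvd_cube_iff)
  have not_both: False if "comaximal x r" "eis_lambda dvd x" for x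
    using comaximal_dvd[OF that(1,2) r] eis_lambda_not_dvd_1
    unfolding comaximal_def by (metis dvd_add dvd_triv_right)
  have "\<not> eis_lambda dvd a"
    using not_both[OF pr] a by (auto simp: eis_lambda_dvd_mult_iff eis_lambda_dvd_cube_iff)
  then obtain s where s: "s = 1 \<or> s = - 1" "9 dvd a ^ 3 - of_int s" by (rule eis_cube_mod_9)
  have "\<not> eis_lambda dvd b"
    using not_both[OF qr] b by (auto simp: eis_lambda_dvd_mult_iff eis_lambda_dvd_cube_iff)
  then obtain t where t: "t = 1 \<or> t = - 1" "9 dvd b ^ 3 - of_int t" by (rule eis_cube_mod_9)
  have "(9::eisenstein) = 3 * 3" by simp
  then have "(3::eisenstein) dvd 9" by (metis dvd_triv_left)
  then have a3: "3 dvd a ^ 3 - of_int s" and b3: "3 dvd b ^ 3 - of_int t"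
    using s t dvd_trans by blast+
  have "eis_lambda ^ 3 dvd c ^ 3" using lc by (rule dvd_power_same)
  then have c3: "3 dvd c ^ 3" unfolding eis_lambda_cube by (rule dvd_mult_left)
  \<comment> \<open>Modulo 3 the cubes of \<open>a\<close> and \<open>b\<close> become the signs
    \<open>s\<close> and \<open>t\<close>, and \<open>c ^ 3\<close> disappears.\<close>
  have "u1 * of_int s + u2 * of_int t =
      - (u1 * (a ^ 3 - of_int s)) - u2 * (b ^ 3 - of_int t) - u3 * c ^ 3"
    using sum a b c by (simp add: algebra_simps eq_neg_iff_add_eq_0)
  moreover have "3 dvd \<dots>"
    by (intro dvd_diff dvd_mult a3 b3 c3) (use a3 in simp)
  ultimately have "3 dvd u1 * of_int s + u2 * of_int t" by simp
  moreover have "u1 * of_int s dvd 1" "u2 * of_int t dvd 1" using a b s t by auto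
  ultimately have "u2 * of_int t = - (u1 * of_int s)" by (intro eis_units_cong_3)
  then have "u2 = - (u1 * of_int s) * of_int t" using t by auto
  then have u2: "u2 = u1 * of_int (- s * t)" by (simp add: algebra_simps)
  define k where "k = - s * t"
  have k: "k = 1 \<or> k = - 1" using s t k_def by auto
  obtain v where v: "1 = u1 * v" using a by (elim dvdE)
  \<comment> \<open>A sign is its own cube, so it can be absorbed into \<open>b\<close>.\<close>
  have k3: "of_int k = (of_int k :: eisenstein) ^ 3" using k by auto
  have "v * (u1 * a ^ 3 + u1 * of_int k * b ^ 3 + u3 * c ^ 3) = 0"
    using sum a b c u2 k_def by simp
  then have "(u1 * v) * a ^ 3 + (u1 * v) * of_int k * b ^ 3 + (v * u3) * c ^ 3 = 0"
    by (simp add: algebra_simps)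
  then have "a ^ 3 + of_int k * b ^ 3 + (v * u3) * c ^ 3 = 0" using v by simp
  then have "a ^ 3 + (of_int k * b) ^ 3 + (v * u3) * c ^ 3 = 0"
    using k3 by (simp add: power_mult_distrib)
  moreover have "v * u3 dvd 1" using v c by (metis dvd_triv_right mult_dvd_mono mult_1)
  moreover have "comaximal a (of_int k * b)"
  proof (rule comaximal_dvd[OF com])
    show "a dvd p" unfolding a by (simp add: power3_eq_cube)
    have "b dvd q" unfolding b by (simp add: power3_eq_cube)
    then show "of_int k * b dvd q" using k by auto
  qed
  moreover have "c \<noteq> 0" using nz c by auto
  moreover have "eis_norm c \<le> eis_norm e"
  proof -
    have "eis_norm p * eis_norm q * eis_norm r = eis_norm e ^ 3"
      using prod eis_norm_unit[OF w] by (metis eis_norm_mult eis_norm_power mult_1)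
    moreover have "eis_norm r = eis_norm c ^ 3"
      using c eis_norm_unit by (simp add: eis_norm_mult eis_norm_power)
    moreover have "eis_norm p * eis_norm q \<ge> 1"
      using eis_norm_pos[of "p * q"] nz by (simp add: eis_norm_mult)
    ultimately have "eis_norm c ^ 3 \<le> eis_norm e ^ 3"
      using eis_norm_nonneg[of r] by (metis mult_1 mult_right_mono)
    then show ?thesis using eis_norm_nonneg power_mono_iff[of _ _ 3] by simp
  qed
  ultimately show ?thesis using lc by blast
qed

lemma eis_descent_step:
  fixes a b c u :: eisenstein
  assumes eq: "a ^ 3 + b ^ 3 + u * c ^ 3 = 0" and u: "u dvd 1" and com: "comaximal a b"
    and lc: "eis_lambda dvd c" and c: "c \<noteq> 0"
  shows "\<exists>a' b' c' u'. a' ^ 3 + b' ^ 3 + u' * c' ^ 3 = 0 \<and> u' dvd 1 \<and> comaximal a' b' \<and>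
    eis_lambda dvd c' \<and> c' \<noteq> 0 \<and> eis_norm c' < eis_norm c"
proof -
  obtain e where e: "c = eis_lambda * e" using lc by (elim dvdE)
  have e0: "e \<noteq> 0" using c e by auto
  have u3: "u * c ^ 3 = - (a ^ 3 + b ^ 3)" using eq by (simp only: add_eq_0_iff)
  obtain v where v: "1 = u * v" using u by (elim dvdE)
  have not_both: "\<not> (eis_lambda dvd a \<and> eis_lambda dvd b)"
    using com eis_lambda_not_dvd_1 unfolding comaximal_def by (metis dvd_add dvd_mult)
  have lab3: "eis_lambda dvd a ^ 3 + b ^ 3"
    using u3 lc by (metis dvd_minus_iff dvd_mult eis_lambda_dvd_cube_iff)
  have la: "\<not> eis_lambda dvd a" and lb: "\<not> eis_lambda dvd b"
    using lab3 not_both by (metis eis_lambda_dvd_cube_iff dvd_add_right_iff dvd_add_left_iff)+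
  obtain s where s: "s = 1 \<or> s = - 1" "9 dvd a ^ 3 - of_int s" using la by (rule eis_cube_mod_9)
  obtain t where t: "t = 1 \<or> t = - 1" "9 dvd b ^ 3 - of_int t" using lb by (rule eis_cube_mod_9)
  have st9: "9 dvd (a ^ 3 + b ^ 3) - of_int (s + t)"
    using dvd_add[OF s(2) t(2)] by (simp add: algebra_simps)
  have nine: "(9::eisenstein) = 3 * (eis_lambda * (eis_lambda * (eis_omega + 1)))"
    using eis_lambda_square by (simp add: power2_eq_square mult.assoc)
  have "eis_lambda dvd 9" unfolding nine by simp
  then have "eis_lambda dvd (a ^ 3 + b ^ 3) - of_int (s + t)" using st9 by (rule dvd_trans)
  from dvd_diff[OF lab3 this] have "eis_lambda dvd of_int (s + t)"
    by (simp only: diff_diff_eq2 add_diff_cancel_left')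
  \<comment> \<open>The sum of two signs is 0 or \<open>2\<close> up to sign, and
    \<open>eis_lambda\<close> does not divide 2.\<close>
  then have "s + t = 0"
    using s t by (auto simp: eis_of_int eis_lambda_dvd_iff)
  then have "9 dvd a ^ 3 + b ^ 3" using st9 by simp
  then have "9 dvd u * c ^ 3" unfolding u3 by (simp only: dvd_minus_iff)
  then have "9 dvd v * (u * c ^ 3)" by (rule dvd_mult)
  then have "9 dvd c ^ 3" using v by (metis mult.assoc mult.commute mult_1)
  \<comment> \<open>Since 9 is \<open>eis_lambda ^ 4\<close> up to a unit and \<open>c ^ 3\<close>
    is \<open>eis_lambda ^ 3 * e ^ 3\<close>, cancelling leaves a factor \<open>eis_lambda\<close>
    in \<open>e ^ 3\<close>.\<close>
  also have "c ^ 3 = 3 * (eis_lambda * (- eis_omega)) * e ^ 3"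
    unfolding e power_mult_distrib eis_lambda_cube ..
  finally have "3 * (eis_lambda * (eis_lambda * (eis_omega + 1))) dvd
      3 * (eis_lambda * ((- eis_omega) * e ^ 3))"
    unfolding nine by (simp only: mult.assoc)
  moreover have "(3::eisenstein) \<noteq> 0"
    by (simp add: eis_numeral zero_eisenstein_def)
  ultimately have "eis_lambda * (eis_omega + 1) dvd (- eis_omega) * e ^ 3"
    using eis_lambda_nonzero by (simp only: dvd_mult_cancel_left) simp
  then have "eis_lambda dvd (- eis_omega) * e ^ 3" by (rule dvd_mult_left)
  moreover have "\<not> eis_lambda dvd - eis_omega"
    by (simp add: eis_omega_def eis_lambda_dvd_iff)
  ultimately have le: "eis_lambda dvd e"
    by (metis eis_lambda_dvd_mult_iff eis_lambda_dvd_cube_iff)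
  have cube: "(a + b) ^ 3 = (a ^ 3 + b ^ 3) + 3 * (a * b * (a + b))"
    by (simp add: power3_eq_cube algebra_simps)
  have "eis_lambda dvd 3" using eis_lambda_cube eis_lambda_square
    by (metis dvd_mult2 dvd_triv_left power2_eq_square)
  then have "eis_lambda dvd (a + b) ^ 3" unfolding cube by (intro dvd_add[OF lab3] dvd_mult2)
  then have "eis_lambda dvd a + b" by (simp only: eis_lambda_dvd_cube_iff)
  then obtain p where p: "a + b = eis_lambda * p" by (elim dvdE)
  \<comment> \<open>Substituting \<open>a = eis_lambda * p - b\<close> gives
    \<open>a + \<omega> * b = eis_lambda * (p - b)\<close> and
    \<open>a + \<omega> ^ 2 * b = eis_lambda * (p + \<omega> ^ 2 * b)\<close>; the divisions by
    \<open>eis_lambda\<close> are thus already carried out.\<close>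
  define q where "q = eis_omega * (p - b)"
  define r where "r = eis_omega\<^sup>2 * p + eis_omega * b"
  have omega3: "eis_omega ^ 3 = 1"
    by (simp add: eis_omega_def one_eisenstein_def power3_eq_cube)
  have a: "a = eis_lambda * p - b" using p by (metis add_diff_cancel_right')
  have b: "b = p - eis_omega\<^sup>2 * q"
  proof -
    have "eis_omega\<^sup>2 * q = eis_omega ^ 3 * (p - b)"
      unfolding q_def by (simp add: power3_eq_cube power2_eq_square algebra_simps)
    then show ?thesis using omega3 by simp
  qed
  have sum: "p + q + r = 0"
    unfolding q_def r_def eis_omega_square by (simp add: algebra_simps)
  have "eis_lambda ^ 3 * (p * q * r) = a ^ 3 + b ^ 3"
    unfolding a q_def r_def
    by (cases p; cases b)
      (simp add: eis_lambda_def eis_omega_def power3_eq_cube power2_eq_square algebra_simps)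
  also have "\<dots> = - (u * c ^ 3)" by (simp only: u3 minus_minus)
  also have "\<dots> = eis_lambda ^ 3 * ((- u) * e ^ 3)"
    unfolding e by (simp add: power_mult_distrib algebra_simps)
  finally have prod: "p * q * r = (- u) * e ^ 3"
    by (rule mult_left_cancel[THEN iffD1, rotated]) (simp add: eis_lambda_nonzero)
  \<comment> \<open>Both \<open>a\<close> and \<open>b\<close> are linear combinations of
    \<open>p\<close> and \<open>q\<close>, so a Bezout identity for them becomes one for
    \<open>p\<close> and \<open>q\<close>.\<close>
  have pq: "comaximal p q"
  proof -
    obtain k l where kl: "k * a + l * b = 1" using com unfolding comaximal_def by auto
    have "(k * (eis_lambda - 1) + l) * p + (k - l) * eis_omega\<^sup>2 * q =
        k * (eis_lambda * p - (p - eis_omega\<^sup>2 * q)) + l * (p - eis_omega\<^sup>2 * q)"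
      by (simp add: algebra_simps)
    also have "\<dots> = k * a + l * b" unfolding a b[symmetric] ..
    finally show ?thesis unfolding comaximal_def kl by blast
  qed
  have pr: "comaximal p r" using comaximal_add_eq_0[OF pq sum] .
  have qr: "comaximal q r"
    using comaximal_add_eq_0[of q p r] pq sum comaximal_commute by (metis add.commute)
  have u': "- u dvd 1" using u by simp
  have "eis_norm c = 3 * eis_norm e" unfolding e eis_norm_mult eis_norm_lambda ..
  then have less: "eis_norm e < eis_norm c" using eis_norm_pos[OF e0] by simp
  have "eis_lambda dvd p * q * r" unfolding prod using le by (simp add: eis_lambda_dvd_cube_iff)
  \<comment> \<open>The relations are symmetric in \<open>p\<close>, \<open>q\<close>,
    \<open>r\<close>, so whichever factor is divisible by \<open>eis_lambda\<close> can be placed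
    last.\<close>
  then consider "eis_lambda dvd p" | "eis_lambda dvd q" | "eis_lambda dvd r"
    by (auto simp: eis_lambda_dvd_mult_iff)
  then have "\<exists>a b c u. a ^ 3 + b ^ 3 + u * c ^ 3 = 0 \<and> u dvd 1 \<and> comaximal a b \<and>
    eis_lambda dvd c \<and> c \<noteq> 0 \<and> eis_norm c \<le> eis_norm e"
  proof cases
    case 1
    have "q + r + p = 0" "q * r * p = (- u) * e ^ 3"
      using sum prod by (simp_all add: ac_simps)
    then show ?thesis using eis_cubes_from_factors u' e0 qr 1 by blast
  next
    case 2
    have "p + r + q = 0" "p * r * q = (- u) * e ^ 3"
      using sum prod by (simp_all add: ac_simps)
    then show ?thesis using eis_cubes_from_factors u' e0 pr 2 by blast
  next
    case 3
    show ?thesis using eis_cubes_from_factors[OF sum prod u' e0 pq 3] .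
  qed
  then show ?thesis using less by (meson le_less_trans)
qed

lemma eis_no_solution:
  fixes a b c u :: eisenstein
  assumes "a ^ 3 + b ^ 3 + u * c ^ 3 = 0" "u dvd 1" "comaximal a b" "eis_lambda dvd c"
  shows "c = 0"
proof (rule ccontr)
  assume "c \<noteq> 0"
  with assms show False
  proof (induction "nat (eis_norm c)" arbitrary: a b c u rule: less_induct)
    case less
    obtain a' b' c' u' where *: "a' ^ 3 + b' ^ 3 + u' * c' ^ 3 = 0" "u' dvd 1" "comaximal a' b'"
      "eis_lambda dvd c'" "c' \<noteq> 0" "eis_norm c' < eis_norm c"
      using eis_descent_step[OF less.prems] by blast
    then have "nat (eis_norm c') < nat (eis_norm c)" using eis_norm_nonneg[of c'] by simp
    then show False using less.hyps * by blast
  qed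
qed

section \<open>Sums of cubes of integers\<close>

lemma int_cubes_no_solution_dvd:
  fixes x y z :: int
  assumes eq: "x ^ 3 + y ^ 3 + z ^ 3 = 0" and "coprime x y" and z: "3 dvd z"
  shows "z = 0"
proof -
  have "of_int x ^ 3 + of_int y ^ 3 + 1 * of_int z ^ 3 = (of_int (x ^ 3 + y ^ 3 + z ^ 3) :: eisenstein)"
    by simp
  then have "of_int x ^ 3 + of_int y ^ 3 + 1 * of_int z ^ 3 = (0 :: eisenstein)"
    unfolding eq by simp
  moreover have "comaximal (of_int x) (of_int y :: eisenstein)"
  proof -
    obtain s t where "s * x + t * y = 1" using bezout_int[of x y] assms(2) by auto
    then have "of_int s * of_int x + of_int t * of_int y = (1 :: eisenstein)"
      by (metis of_int_1 of_int_add of_int_mult)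
    then show ?thesis unfolding comaximal_def by blast
  qed
  moreover have "eis_lambda dvd of_int z" using z by (simp add: eis_of_int eis_lambda_dvd_iff)
  ultimately have "of_int z = (0 :: eisenstein)" using eis_no_solution by (metis one_dvd)
  then show ?thesis by (simp add: eis_of_int zero_eisenstein_def)
qed

lemma int_cube_mod_9:
  fixes x :: int
  assumes "\<not> 3 dvd x"
  shows "x ^ 3 mod 9 = 1 \<or> x ^ 3 mod 9 = 8"
proof -
  have "x mod 9 = 1 \<or> x mod 9 = 2 \<or> x mod 9 = 4 \<or> x mod 9 = 5 \<or> x mod 9 = 7 \<or> x mod 9 = 8"
    using assms by presburger
  moreover have "x ^ 3 mod 9 = (x mod 9) ^ 3 mod 9" by (simp add: power_mod)
  ultimately show ?thesis by auto
qed

text \<open>With \<open>Z = - int z\<close> the equation is symmetric, so the descent excludes 3 as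
  a divisor of any of the three numbers. The cubes are then 1 or -1 modulo 9, and three such
  residues never sum to 0.\<close>

lemma fermat_3_coprime:
  fixes x y z :: nat
  assumes eq: "x ^ 3 + y ^ 3 = z ^ 3" and xy: "coprime x y" and xz: "coprime x z"
    and yz: "coprime y z" and pos: "x > 0" "y > 0" "z > 0"
  shows False
proof -
  define X Y Z where XYZ: "X = int x" "Y = int y" "Z = - int z"
  have "X ^ 3 + Y ^ 3 = int (x ^ 3 + y ^ 3)" unfolding XYZ by simp
  then have sum: "X ^ 3 + Y ^ 3 + Z ^ 3 = 0" unfolding eq XYZ by simp
  then have "Y ^ 3 + Z ^ 3 + X ^ 3 = 0" "X ^ 3 + Z ^ 3 + Y ^ 3 = 0" by simp_all
  moreover have "coprime X Y" "coprime X Z" "coprime Y Z" using xy xz yz unfolding XYZ by simp_all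
  moreover have "X \<noteq> 0" "Y \<noteq> 0" "Z \<noteq> 0" using pos unfolding XYZ by simp_all
  ultimately have "\<not> 3 dvd X" "\<not> 3 dvd Y" "\<not> 3 dvd Z"
    using int_cubes_no_solution_dvd sum by blast+
  then have "X ^ 3 mod 9 = 1 \<or> X ^ 3 mod 9 = 8" "Y ^ 3 mod 9 = 1 \<or> Y ^ 3 mod 9 = 8"
    "Z ^ 3 mod 9 = 1 \<or> Z ^ 3 mod 9 = 8" using int_cube_mod_9 by blast+
  moreover have False if "A + B + C = 0" "A mod 9 = 1 \<or> A mod 9 = 8" "B mod 9 = 1 \<or> B mod 9 = 8"
    "C mod 9 = 1 \<or> C mod 9 = 8" for A B C :: int
    using that by presburger
  ultimately show False using sum by blast
qed

text \<open>The product is homogeneous of degree 3, so \<open>g ^ 3\<close> splits off; as it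
  divides \<open>d ^ 3\<close>, the remaining cofactor is again a cube.\<close>

lemma no_sum_with_cube_product:
  fixes a b c d :: nat
  assumes sum: "a + b = c" and prod: "a * b * c = d ^ 3" and pos: "a > 0" "b > 0"
  shows False
proof -
  define g where "g = gcd a b"
  have g: "g \<noteq> 0" using pos g_def by simp
  obtain x y where xy: "a = x * g" "b = y * g" "coprime x y"
    using gcd_coprime_exists[of a b] g unfolding g_def by blast
  have "g ^ 3 * (x * y * (x + y)) = a * b * (a + b)"
    unfolding xy(1,2) by (simp add: power3_eq_cube algebra_simps)
  also have "\<dots> = d ^ 3" unfolding sum prod ..
  finally have gd: "g ^ 3 * (x * y * (x + y)) = d ^ 3" .
  then have "g ^ 3 dvd d ^ 3" by (metis dvd_triv_left)
  then have "g dvd d" by simp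
  then obtain e where "d = g * e" by (elim dvdE)
  then have "g ^ 3 * (x * y * (x + y)) = g ^ 3 * e ^ 3"
    using gd by (simp add: power_mult_distrib)
  then have "x * y * (x + y) = e ^ 3" using g by simp
  then have cube: "is_nth_power 3 (x * y * (x + y))" by (metis is_nth_power_nth_power)
  have cop: "coprime x (x + y)" "coprime y (x + y)"
    using xy(3) gcd_add2[of x y] gcd_add2[of y x]
    by (simp_all add: coprime_iff_gcd_eq_1 add.commute gcd.commute)
  then have "coprime (x * y) (x + y)" by simp
  then have "is_nth_power 3 (x * y)" "is_nth_power 3 (x + y)"
    using cube is_nth_power_mult_coprime_nat_iff by blast+
  moreover from this(1) have "is_nth_power 3 x" "is_nth_power 3 y"
    using xy(3) is_nth_power_mult_coprime_nat_iff by blast+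
  ultimately obtain i j k where ijk: "x = i ^ 3" "y = j ^ 3" "x + y = k ^ 3"
    unfolding is_nth_power_def by metis
  have "x > 0" "y > 0" using pos xy by auto
  then have "i ^ 3 > 0" "j ^ 3 > 0" "k ^ 3 > 0" unfolding ijk[symmetric] by simp_all
  moreover have "coprime (i ^ 3) (j ^ 3)" "coprime (i ^ 3) (k ^ 3)" "coprime (j ^ 3) (k ^ 3)"
    unfolding ijk[symmetric] by (rule xy(3) cop)+
  moreover have "i ^ 3 + j ^ 3 = k ^ 3" unfolding ijk[symmetric] ..
  ultimately show False using fermat_3_coprime[of i j k] by simp
qed

section \<open>The system of equations\<close>

lemma positive_solutions_empty:
  assumes "3 dvd n"
  shows "positive_solutions n = {}"
proof -
  \<comment> \<open>The order \<open>k * 3\<close> lets \<open>power_mult\<close> turn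
    \<open>D ^ n\<close> into the cube of \<open>D ^ k\<close>.\<close>
  obtain k where n: "n = k * 3" using assms by (metis dvdE mult.commute)
  show ?thesis
    unfolding positive_solutions_def n power_mult using no_sum_with_cube_product by blast
qed

lemma positive_solutions_infinite:
  assumes "\<not> 3 dvd n"
  shows "infinite (positive_solutions n)"
proof -
  obtain s m where sm: "3 * s + 1 = n * m"
  proof -
    have "n = 3 * (n div 3) + 1 \<or> n = 3 * (n div 3) + 2" using assms by presburger
    then obtain k where "n = 3 * k + 1 \<or> n = 3 * k + 2" by blast
    \<comment> \<open>For \<open>n = 3 * k + 2\<close> this is
      \<open>3 * (2 * k + 1) + 1 = 2 * n\<close>.\<close>
    then show thesis using that[of k 1] that[of "2 * k + 1" 2] by auto
  qed
  have n: "n > 0" using assms by (cases n) auto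
  \<comment> \<open>The product of the first three entries is
    \<open>2 ^ (3 * s + 1) * (t + 1) ^ (3 * n)\<close>, where \<open>3 * s + 1 = n * m\<close>;
    using \<open>t + 1\<close> keeps all entries positive.\<close>
  define f where "f t = (2 ^ s * (t + 1) ^ n, 2 ^ s * (t + 1) ^ n, 2 * (2 ^ s * (t + 1) ^ n),
    2 ^ m * (t + 1) ^ 3)" for t :: nat
  have "f t \<in> positive_solutions n" for t
  proof -
    have "k * k * (2 * k) = 2 * k ^ 3" for k :: nat by (simp add: power3_eq_cube)
    then have "2 ^ s * (t + 1) ^ n * (2 ^ s * (t + 1) ^ n) * (2 * (2 ^ s * (t + 1) ^ n)) =
        2 * (2 ^ s * (t + 1) ^ n) ^ 3" .
    also have "\<dots> = 2 ^ (3 * s + 1) * (t + 1) ^ (3 * n)"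
      by (simp add: power_mult_distrib power_mult[symmetric] mult.commute)
    also have "\<dots> = (2 ^ m * (t + 1) ^ 3) ^ n"
      unfolding sm by (simp add: power_mult_distrib power_mult[symmetric] mult.commute)
    finally show ?thesis unfolding positive_solutions_def f_def by simp
  qed
  moreover have "inj f"
  proof
    fix t t'
    assume "f t = f t'"
    then have "2 ^ m * (t + 1) ^ 3 = 2 ^ m * (t' + 1) ^ 3" unfolding f_def by simp
    then have "(t + 1) ^ 3 = (t' + 1) ^ 3" by simp
    then show "t = t'" by (metis Suc_eq_plus1 Suc_inject power_inject_base numeral_3_eq_3 le0)
  qed
  ultimately show ?thesis using infinite_super[of "range f"] finite_imageD[of f UNIV] by blast
qed

theorem theorem2:
  fixes n :: nat
  assumes "n \<ge> 3"
  shows "(\<not> [n = 0] (mod 3) \<longrightarrow> infinite (positive_solutions n)) \<and>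
         ([n = 0] (mod 3) \<longrightarrow> positive_solutions n = {})"
  using positive_solutions_empty positive_solutions_infinite by (simp add: cong_0_iff)

end
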